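(* Let $0<\epsilon<1$ and let $A_1,\ldots,A_n$ be events in a probability space with an $\epsilon$-near-positive dependency graph $G$. Then \[\Pr\Big(\bigwedge_{i=1}^n \overline{A_i}\Big)\ \le\ \prod_{i=1}^n\big[1-(1-\epsilon)\Pr(A_i)\big].\]
   Context: For events $A_1,\ldots,A_n$ and $0<\epsilon<1$, an $\epsilon$-near-positive dependency graph is a simple graph $G$ on vertex set $[n]$ such that (1) $\Pr(A_i\wedge A_j)=0$ whenever $ij\in E(G)$; and (2) for every index $i$ and every subset $T\subseteq\{j\neq i: ij\notin E(G)\}$ with $\Pr(\bigwedge_{j\in T}\overline{A_j})>0$, one has $\Pr(A_i\mid \bigwedge_{j\in T}\overline{A_j})\ge(1-\epsilon)\Pr(A_i)$. *)

theory Defs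
  imports "HOL-Probability.Probability" "Graph_Theory.Pair_Digraph"
begin

text \<open>
  The locale \<open>pair_graph\<close> is the library's notion of a finite simple graph: a symmetric,
  loop-free arc relation on a finite vertex set, so that \<open>ij\<close> is an edge iff
  \<open>(i, j) \<in> parcs G\<close> (equivalently \<open>(j, i) \<in> parcs G\<close>).
\<close>

definition near_positive_dependency_graph ::
  "'a measure \<Rightarrow> real \<Rightarrow> nat \<Rightarrow> (nat \<Rightarrow> 'a set) \<Rightarrow> nat pair_pre_digraph \<Rightarrow> bool" where
  "near_positive_dependency_graph M \<epsilon> n A G \<longleftrightarrow>
     pair_graph G \<and> pverts G = {1..n} \<and>
     (\<forall>i j. (i, j) \<in> parcs G \<longrightarrow> \<P>(\<omega> in M. \<omega> \<in> A i \<and> \<omega> \<in> A j) = 0) \<and>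
     (\<forall>i\<in>{1..n}. \<forall>T. T \<subseteq> {j \<in> {1..n}. j \<noteq> i \<and> (i, j) \<notin> parcs G} \<longrightarrow>
        \<P>(\<omega> in M. \<forall>j\<in>T. \<omega> \<notin> A j) > 0 \<longrightarrow>
        \<P>(\<omega> in M. \<omega> \<in> A i \<bar> \<forall>j\<in>T. \<omega> \<notin> A j) \<ge> (1 - \<epsilon>) * \<P>(\<omega> in M. \<omega> \<in> A i))"

end

theory Submission
  imports Defs
begin

text \<open>
  Reveal the events one at a time. Given that no event of \<open>S\<close> occurs, a neighbour \<open>j \<in> S\<close> of \<open>i\<close>
  imposes no restriction on \<open>A i\<close>, since \<open>A i \<inter> A j\<close> is null. So only the set \<open>T\<close> of non-neighbours
  matters in the joint probability, where near-positive dependence applies, and enlarging \<open>T\<close> back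
  to \<open>S\<close> only decreases the probability of avoidance. Each new event therefore contributes a factor
  of at most \<open>1 - (1 - \<epsilon>) * Pr (A i)\<close>.
\<close>

context prob_space
begin

text \<open>The two events differ only inside the union of the sets \<open>B \<inter> A j\<close>
  with \<open>j \<in> S - T\<close>. This is a finite union of null sets, so the events agree almost
  everywhere.\<close>

lemma prob_avoid_null_intersections:
  assumes "finite S" and "B \<in> events" and "\<And>j. j \<in> S \<Longrightarrow> A j \<in> events"
    and "T \<subseteq> S" and null: "\<And>j. j \<in> S - T \<Longrightarrow> \<P>(\<omega> in M. \<omega> \<in> B \<and> \<omega> \<in> A j) = 0"
  shows "\<P>(\<omega> in M. \<omega> \<in> B \<and> (\<forall>j\<in>S. \<omega> \<notin> A j)) = \<P>(\<omega> in M. \<omega> \<in> B \<and> (\<forall>j\<in>T. \<omega> \<notin> A j))"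
proof -
  have fin: "finite T" using assms(1,4) by (rule finite_subset[rotated])
  have [measurable]: "B \<in> events" "\<And>j. j \<in> S \<Longrightarrow> A j \<in> events" "\<And>j. j \<in> T \<Longrightarrow> A j \<in> events"
    using assms by auto
  have "AE \<omega> in M. \<not> (\<omega> \<in> B \<and> \<omega> \<in> A j)" if "j \<in> S - T" for j
  proof -
    have [measurable]: "A j \<in> events" using that assms(3) by blast
    show ?thesis using null[OF that] by (subst (asm) prob_eq_0) auto
  qed
  then have "AE \<omega> in M. \<forall>j\<in>S - T. \<not> (\<omega> \<in> B \<and> \<omega> \<in> A j)"
    using \<open>finite S\<close> by (subst AE_finite_all) auto
  then have "AE \<omega> in M. (\<omega> \<in> B \<and> (\<forall>j\<in>S. \<omega> \<notin> A j)) \<longleftrightarrow> (\<omega> \<in> B \<and> (\<forall>j\<in>T. \<omega> \<notin> A j))"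
    by (rule AE_mp) (use \<open>T \<subseteq> S\<close> in \<open>auto intro!: AE_I2\<close>)
  then show ?thesis
    using \<open>finite S\<close> fin by (intro prob_eq_AE) measurable
qed

text \<open>Splitting avoidance of \<open>S\<close> according to \<open>B\<close> reduces the claim
  to a lower bound \<open>c * Pr (avoid S)\<close> for the part inside \<open>B\<close>. In the
  application, \<open>c\<close> is \<open>(1 - \<epsilon>) * Pr (A i)\<close> and \<open>T\<close>
  is the set of non-neighbours of \<open>i\<close> in \<open>S\<close>.\<close>

lemma prob_avoid_insert_le:
  assumes "finite S" and "B \<in> events" and "\<And>j. j \<in> S \<Longrightarrow> A j \<in> events"
    and "T \<subseteq> S" and "\<And>j. j \<in> S - T \<Longrightarrow> \<P>(\<omega> in M. \<omega> \<in> B \<and> \<omega> \<in> A j) = 0"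
    and "0 \<le> c"
    and cond: "\<P>(\<omega> in M. \<forall>j\<in>T. \<omega> \<notin> A j) > 0 \<Longrightarrow> c \<le> \<P>(\<omega> in M. \<omega> \<in> B \<bar> \<forall>j\<in>T. \<omega> \<notin> A j)"
  shows "\<P>(\<omega> in M. \<omega> \<notin> B \<and> (\<forall>j\<in>S. \<omega> \<notin> A j)) \<le> (1 - c) * \<P>(\<omega> in M. \<forall>j\<in>S. \<omega> \<notin> A j)"
proof -
  let ?S = "\<P>(\<omega> in M. \<forall>j\<in>S. \<omega> \<notin> A j)" and ?T = "\<P>(\<omega> in M. \<forall>j\<in>T. \<omega> \<notin> A j)"
  have fin: "finite T" using assms(1,4) by (rule finite_subset[rotated])
  note [measurable] = assms(2)
  have [measurable]: "\<And>j. j \<in> S \<Longrightarrow> A j \<in> events" "\<And>j. j \<in> T \<Longrightarrow> A j \<in> events"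
    using assms by auto
  have evT: "{\<omega> \<in> space M. \<forall>j\<in>T. \<omega> \<notin> A j} \<in> events"
    and evS: "{\<omega> \<in> space M. \<forall>j\<in>S. \<omega> \<notin> A j} \<in> events"
    using fin \<open>finite S\<close> by measurable
  have "c * ?S \<le> c * ?T"
    using \<open>T \<subseteq> S\<close> \<open>0 \<le> c\<close> evT by (intro mult_left_mono finite_measure_mono) auto
  also have "\<dots> \<le> \<P>(\<omega> in M. \<omega> \<in> B \<and> (\<forall>j\<in>T. \<omega> \<notin> A j))"
  proof (cases "?T > 0")
    case True
    then show ?thesis using cond by (simp add: cond_prob_def pos_le_divide_eq)
  next
    case False
    \<comment> \<open>Here \<open>cond\<close> gives nothing, but the left side is
      \<open>c * 0\<close>.\<close>
    then have "?T = 0" by (simp add: zero_less_measure_iff)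
    then show ?thesis by simp
  qed
  also have "\<dots> = \<P>(\<omega> in M. \<omega> \<in> B \<and> (\<forall>j\<in>S. \<omega> \<notin> A j))"
    using assms by (intro prob_avoid_null_intersections[symmetric])
  finally have "c * ?S \<le> \<P>(\<omega> in M. \<omega> \<in> B \<and> (\<forall>j\<in>S. \<omega> \<notin> A j))" .
  \<comment> \<open>Complementing in \<open>B\<close> turns the lower bound for the part inside
    \<open>B\<close> into an upper bound for the part outside.\<close>
  moreover have "?S = \<P>(\<omega> in M. \<omega> \<in> B \<and> (\<forall>j\<in>S. \<omega> \<notin> A j))
      + \<P>(\<omega> in M. \<omega> \<notin> B \<and> (\<forall>j\<in>S. \<omega> \<notin> A j))"
    using finite_measure_Diff'[OF evS \<open>B \<in> events\<close>] sets.sets_into_space[OF \<open>B \<in> events\<close>]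
    by (simp add: set_diff_eq Int_def conj_ac)
  ultimately show ?thesis by (simp add: algebra_simps)
qed

end

theorem theorem1:
  fixes M :: "'a measure" and \<epsilon> :: real and n :: nat
    and A :: "nat \<Rightarrow> 'a set" and G :: "nat pair_pre_digraph"
  assumes "prob_space M"
    and "0 < \<epsilon>" and "\<epsilon> < 1"
    and "\<And>i. i \<in> {1..n} \<Longrightarrow> A i \<in> sets M"
    and "near_positive_dependency_graph M \<epsilon> n A G"
  shows "\<P>(\<omega> in M. \<forall>i\<in>{1..n}. \<omega> \<notin> A i)
      \<le> (\<Prod>i=1..n. 1 - (1 - \<epsilon>) * \<P>(\<omega> in M. \<omega> \<in> A i))"
proof -
  interpret prob_space M by fact
  let ?p = "\<lambda>i. \<P>(\<omega> in M. \<omega> \<in> A i)"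
  \<comment> \<open>Generalising from \<open>{1..n}\<close> to any subset \<open>S\<close> allows
    induction on finite sets; the order in which events are added is irrelevant.\<close>
  have "\<P>(\<omega> in M. \<forall>i\<in>S. \<omega> \<notin> A i) \<le> (\<Prod>i\<in>S. 1 - (1 - \<epsilon>) * ?p i)" if "S \<subseteq> {1..n}" for S
    using finite_subset[OF that finite_atLeastAtMost] that
  proof (induction S rule: finite_induct)
    case empty
    show ?case by simp
  next
    case (insert i S)
    define T where "T = {j \<in> S. (i, j) \<notin> parcs G}"
    have T: "T \<subseteq> {j \<in> {1..n}. j \<noteq> i \<and> (i, j) \<notin> parcs G}"
      using insert.hyps insert.prems by (auto simp: T_def)
    have i: "i \<in> {1..n}" using insert.prems by simp
    have "\<P>(\<omega> in M. \<forall>j\<in>insert i S. \<omega> \<notin> A j)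
        \<le> (1 - (1 - \<epsilon>) * ?p i) * \<P>(\<omega> in M. \<forall>j\<in>S. \<omega> \<notin> A j)"
      unfolding Set.ball_simps(7)
    proof (rule prob_avoid_insert_le[where T = T])
      show "\<P>(\<omega> in M. \<omega> \<in> A i \<and> \<omega> \<in> A j) = 0" if "j \<in> S - T" for j
        using that assms(5) by (auto simp: T_def near_positive_dependency_graph_def)
      show "(1 - \<epsilon>) * ?p i \<le> \<P>(\<omega> in M. \<omega> \<in> A i \<bar> \<forall>j\<in>T. \<omega> \<notin> A j)"
        if "\<P>(\<omega> in M. \<forall>j\<in>T. \<omega> \<notin> A j) > 0"
        using that assms(5) i T unfolding near_positive_dependency_graph_def by blast
    qed (use insert assms(3,4) in \<open>auto simp: T_def\<close>)
    \<comment> \<open>The induction hypothesis may be multiplied by the new factor, which is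
      nonnegative because \<open>1 - \<epsilon>\<close> and \<open>?p i\<close> both lie in
      [0, 1].\<close>
    also have "\<dots> \<le> (1 - (1 - \<epsilon>) * ?p i) * (\<Prod>j\<in>S. 1 - (1 - \<epsilon>) * ?p j)"
      using insert assms(2,3) by (intro mult_left_mono) (auto intro!: mult_le_one)
    finally show ?case using insert.hyps by simp
  qed
  then show ?thesis by simp
qed

end
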